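(* Let $n\ge 1$, let $1<p<\infty$, let $q$ be the conjugate of $p$ (i.e. $\frac1p+\frac1q=1$), and let $r=(r_1,\ldots,r_n)$ with $r_i>0$ for $i=1,\ldots,n$. Suppose that $\ell:\mathbb{R}[\underline{X}]\to\mathbb{R}$ is a linear functional such that the sequence $s(\alpha)=\ell(\underline{X}^\alpha)$, $\alpha\in\mathbb{N}^n$, satisfies $$\sum_{\alpha\in\mathbb{N}^n}|s(\alpha)|^q\,r_1^{-\frac{q}{p}\alpha_1}\cdots r_n^{-\frac{q}{p}\alpha_n}<\infty.$$ Then $\ell$ is positive semidefinite if and only if there exists a positive Borel measure $\mu$ on $K=\prod_{i=1}^n[-r_i^{1/p},r_i^{1/p}]$ such that $\ell(f)=\int_K f\,d\mu$ for all $f\in\mathbb{R}[\underline{X}]$.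
   Context: Here $\mathbb{R}[\underline{X}]=\mathbb{R}[X_1,\ldots,X_n]$, $\mathbb{N}=\{0,1,2,\ldots\}$, and $\underline{X}^\alpha=X_1^{\alpha_1}\cdots X_n^{\alpha_n}$. A linear functional $\ell:\mathbb{R}[\underline{X}]\to\mathbb{R}$ is positive semidefinite if $\ell(h^2)\ge 0$ for every $h\in\mathbb{R}[\underline{X}]$. Representation of $\ell$ by a measure $\mu$ includes that all polynomials are $\mu$-integrable. *)

theory Defs
  imports "HOL-Analysis.Analysis" "HOL-Analysis.Finite_Function_Topology"
begin

text \<open>
  The polynomial ring in the variables indexed by the finite type \<open>'n\<close>: a polynomial is the finitely
  supported family of its coefficients, indexed by exponents. The ring structure (convolution product)
  is that of \<^theory>\<open>HOL-Library.Poly_Mapping\<close>, and the real vector space structure that of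
  \<^theory>\<open>HOL-Analysis.Finite_Function_Topology\<close>.
\<close>

type_synonym 'n multi_index = "'n \<Rightarrow>\<^sub>0 nat"

type_synonym 'n real_mpoly = "'n multi_index \<Rightarrow>\<^sub>0 real"

definition monomial :: "'n multi_index \<Rightarrow> 'n real_mpoly" where
  "monomial \<alpha> = Poly_Mapping.single \<alpha> 1"

definition mpoly_eval :: "'n::finite real_mpoly \<Rightarrow> real ^ 'n \<Rightarrow> real" where
  "mpoly_eval f x =
     (\<Sum>\<alpha>\<in>Poly_Mapping.keys f. Poly_Mapping.lookup f \<alpha> * (\<Prod>i\<in>UNIV. (x $ i) ^ Poly_Mapping.lookup \<alpha> i))"

definition positive_semidefinite :: "('n real_mpoly \<Rightarrow> real) \<Rightarrow> bool" where
  "positive_semidefinite L \<longleftrightarrow> (\<forall>h. 0 \<le> L (h\<^sup>2))"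

text \<open>Integrability is required explicitly because \<open>integral\<^sup>L\<close> is 0 for non-integrable functions.\<close>

definition represented_by :: "('n::finite real_mpoly \<Rightarrow> real) \<Rightarrow> (real ^ 'n) measure \<Rightarrow> bool" where
  "represented_by L \<mu> \<longleftrightarrow>
     (\<forall>f. integrable \<mu> (mpoly_eval f) \<and> L f = (\<integral>x. mpoly_eval f x \<partial>\<mu>))"

definition borel_measure_on :: "(real ^ 'n::finite) set \<Rightarrow> (real ^ 'n) measure \<Rightarrow> bool" where
  "borel_measure_on K \<mu> \<longleftrightarrow> sets \<mu> = sets (restrict_space borel K)"

end

theory Submission
  imports Defs "HOL-Probability.Helly_Selection" "HOL-Real_Asymp.Real_Asymp"
begin

text \<open>
  The main task is to construct a measure from a functional. Put \<open>R i = r i powr (1 / p)\<close>. The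
  weighted summability condition bounds each of its terms, and this amounts to a geometric growth
  bound \<open>\<bar>L (X\<^sup>\<alpha>)\<bar> \<le> C * (\<Prod>i. R i ^ \<alpha> i)\<close>. From there on the argument is a proof of the theorem of
  Berg and Maserick, in three stages.
  
  Positivity: the variables \<open>y i = X\<^sub>i / R i\<close> have powers that stay bounded under \<open>L\<close>. Cauchy--Schwarz
  shows that \<open>k \<mapsto> L (y\<^sup>2\<^sup>k h\<^sup>2)\<close> is log-convex; being bounded, it cannot increase, so
  \<open>L (y\<^sup>2 h\<^sup>2) \<le> L (h\<^sup>2)\<close> and then \<open>\<bar>L (y h\<^sup>2)\<bar> \<le> L (h\<^sup>2)\<close>. Hence \<open>f \<mapsto> L ((1 + y i) f)\<close> and
  \<open>f \<mapsto> L ((1 - y i) f)\<close> are again positive semidefinite with bounded powers, and iteration gives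
  \<open>L (\<Prod>i. (1 + y i) ^ a i * (1 - y i) ^ b i) \<ge> 0\<close>
  (\<open>psd_power_bounded_product_nonneg\<close>).
  
  Discretisation: in the variables \<open>u i = (1 + y i) / 2\<close> those products are, up to positive constants,
  the Bernstein basis on the unit cube. The values of \<open>L\<close> on the basis of degree \<open>N\<close> are therefore
  the weights of a discrete measure on the grid \<open>{0, 1/N, \<dots>, 1}\<^sup>n\<close>, and Bernstein polynomials
  reproduce factorial moments exactly, so the moments of these measures converge to
  \<open>L (\<Prod>i. u i ^ a i)\<close>.
  
  Compactness: a weak limit of the discrete measures represents \<open>L\<close>
  (\<open>positive_on_Bernstein_imp_moments\<close>). A subsequence that converges weakly is found by lifting the
  measures to the unit interval along Schoenberg's space-filling curve, applying Helly's selection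
  theorem there, and pushing the limit forward (\<open>discrete_measures_on_cube_convergent_subsequence\<close>).

  The converse holds because evaluation is multiplicative, so that \<open>L (h\<^sup>2)\<close> is the integral of a
  square.
\<close>

section \<open>Positive semidefinite functionals with bounded powers\<close>

lemma psd_Cauchy_Schwarz:
  fixes L :: "'a::{comm_ring_1, real_algebra_1} \<Rightarrow> real"
  assumes "linear L" and psd: "\<And>h. 0 \<le> L (h * h)"
  shows "(L (f * g))\<^sup>2 \<le> L (f * f) * L (g * g)"
proof -
  interpret linear L by fact
  have quadratic: "0 \<le> L (f * f) + 2 * t * L (f * g) + t\<^sup>2 * L (g * g)" for t
  proof -
    have "(f + t *\<^sub>R g) * (f + t *\<^sub>R g) = f * f + (2 * t) *\<^sub>R (f * g) + t\<^sup>2 *\<^sub>R (g * g)"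
      by (simp add: algebra_simps power2_eq_square scaleR_2 flip: scaleR_scaleR)
    then show ?thesis
      using psd[of "f + t *\<^sub>R g"] by (simp add: add scale)
  qed
  show ?thesis
  proof (cases "L (g * g) = 0")
    case True
    have "L (f * g) = 0"
    proof (rule ccontr)
      assume "L (f * g) \<noteq> 0"
      then show False
        \<comment> \<open>Here the quadratic is an affine function of \<open>t\<close>, negative for this \<open>t\<close>.\<close>
        using quadratic[of "- (L (f * f) + 1) / (2 * L (f * g))"] True by (simp add: field_simps)
    qed
    with True show ?thesis by simp
  next
    case False
    then have pos: "0 < L (g * g)" using psd[of g] by simp
    have "0 \<le> L (f * f) - (L (f * g))\<^sup>2 / L (g * g)"
      using quadratic[of "- L (f * g) / L (g * g)"] False
      by (simp add: power2_eq_square field_simps)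
    then show ?thesis
      using pos by (simp add: field_simps)
  qed
qed

text \<open>
  In a log-convex sequence the ratios of consecutive terms increase, so one step upwards from
  \<open>a 0\<close> to \<open>a 1\<close> forces geometric growth.
\<close>

lemma log_convex_bounded_le:
  fixes a :: "nat \<Rightarrow> real"
  assumes nonneg: "\<And>k. 0 \<le> a k"
    and convex: "\<And>k. (a (Suc k))\<^sup>2 \<le> a k * a (Suc (Suc k))"
    and bounded: "\<And>k. a k \<le> C"
  shows "a 1 \<le> a 0"
proof (rule ccontr)
  assume less: "\<not> a 1 \<le> a 0"
  have a0: "0 < a 0"
  proof -
    have "0 < (a 1)\<^sup>2" using less nonneg[of 0] by simp
    then have "a 0 \<noteq> 0" using convex[of 0] by (auto simp del: zero_less_power2)
    then show ?thesis using nonneg[of 0] by simp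
  qed
  define c where "c = a 1 / a 0"
  have c: "1 < c" using less a0 by (simp add: c_def)
  have step: "0 < a k \<and> c * a k \<le> a (Suc k)" for k
  proof (induction k)
    case 0
    then show ?case using a0 by (simp add: c_def)
  next
    case (Suc k)
    have "0 < c * a k" using Suc c by simp
    then have pos: "0 < a (Suc k)" using Suc by linarith
    \<comment> \<open>Log-convexity passes the ratio bound on to the next index.\<close>
    have "c * a k * a (Suc k) \<le> (a (Suc k))\<^sup>2"
      using Suc pos by (simp add: power2_eq_square)
    also have "\<dots> \<le> a k * a (Suc (Suc k))" by (rule convex)
    finally have "a k * (c * a (Suc k)) \<le> a k * a (Suc (Suc k))" by (simp add: ac_simps)
    then show ?case using pos Suc by simp
  qed
  have growth: "c ^ k * a 0 \<le> a k" for k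
  proof (induction k)
    case (Suc k)
    have "c ^ Suc k * a 0 \<le> c * a k" using Suc c by (simp add: mult.assoc)
    then show ?case using step[of k] by linarith
  qed simp
  obtain k where "C / a 0 < c ^ k"
    using real_arch_pow[OF c] by blast
  then have "C < c ^ k * a 0" using a0 by (simp add: field_simps)
  then show False using growth[of k] bounded[of k] by linarith
qed

text \<open>
  These are the states of an iteration: multiplying the argument of such a functional by
  \<open>1 + y i\<close> or by \<open>1 - y i\<close> gives a functional of the same kind. Boundedness is demanded
  for each \<open>h\<close> separately, with a constant that may depend on \<open>h\<close>, because in this form it
  passes from \<open>L\<close> to \<open>\<lambda>f. L (s * f)\<close> by replacing \<open>h\<close> with \<open>s * h\<close>.
\<close>

definition psd_power_bounded ::
    "('i \<Rightarrow> 'a::{comm_ring_1, real_algebra_1}) \<Rightarrow> ('a \<Rightarrow> real) \<Rightarrow> bool" where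
  "psd_power_bounded y L \<longleftrightarrow>
     linear L \<and> (\<forall>h. 0 \<le> L (h * h)) \<and> (\<forall>i h. \<exists>C. \<forall>k. \<bar>L (y i ^ k * h)\<bar> \<le> C)"

text \<open>
  The numbers \<open>L (y\<^sup>2\<^sup>k h\<^sup>2)\<close> are log-convex in \<open>k\<close> by Cauchy--Schwarz, and bounded, so they cannot
  increase from \<open>k = 0\<close> to \<open>k = 1\<close>. In operator language, multiplication by \<open>y i\<close> is a symmetric
  operator for the form \<open>L (f * g)\<close> all of whose powers are bounded on every vector; its norm is
  then at most one.
\<close>

lemma psd_power_bounded_contraction:
  assumes "psd_power_bounded y L"
  shows "L (y i * y i * (h * h)) \<le> L (h * h)"
proof -
  from assms have "linear L" and psd: "\<And>h. 0 \<le> L (h * h)"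
    by (auto simp: psd_power_bounded_def)
  obtain C where C: "\<And>k. \<bar>L (y i ^ k * (h * h))\<bar> \<le> C"
    using assms unfolding psd_power_bounded_def by blast
  define a where "a k = L (y i ^ (2 * k) * (h * h))" for k
  have sq: "y i ^ (2 * k) * (h * h) = (y i ^ k * h) * (y i ^ k * h)" for k
    by (simp only: mult_2 power_add) (simp only: ac_simps)
  have "a 1 \<le> a 0"
  proof (rule log_convex_bounded_le)
    show "0 \<le> a k" for k unfolding a_def sq by (rule psd)
    show "a k \<le> C" for k unfolding a_def using C[of "2 * k"] by linarith
    show "(a (Suc k))\<^sup>2 \<le> a k * a (Suc (Suc k))" for k
    proof -
      have "y i ^ (2 * Suc k) * (h * h) = (y i ^ k * h) * (y i ^ Suc (Suc k) * h)"
        by (simp add: mult_2 power_add)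
      then show ?thesis
        unfolding a_def using psd_Cauchy_Schwarz[OF \<open>linear L\<close> psd, of "y i ^ k * h" "y i ^ Suc (Suc k) * h"]
        by (metis sq)
    qed
  qed
  then show ?thesis by (simp add: a_def power2_eq_square)
qed

text \<open>
  Cauchy--Schwarz for \<open>h\<close> and \<open>y i * h\<close> turns the contraction property into
  \<open>\<bar>L (y i * h\<^sup>2)\<bar> \<le> L (h\<^sup>2)\<close>, which is positivity of the new functional on squares.
\<close>

lemma psd_power_bounded_linear_factor:
  assumes good: "psd_power_bounded y L" and c: "\<bar>c\<bar> \<le> 1"
  shows "psd_power_bounded y (\<lambda>f. L ((1 + c *\<^sub>R y i) * f))"
proof -
  from good have "linear L" and psd: "\<And>h. 0 \<le> L (h * h)"
    by (auto simp: psd_power_bounded_def)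
  interpret linear L by fact
  have expand: "L ((1 + c *\<^sub>R y i) * f) = L f + c * L (y i * f)" for f
    by (simp add: distrib_right add scale)
  have "linear (\<lambda>f. L ((1 + c *\<^sub>R y i) * f))"
    by (rule linearI) (simp_all add: distrib_left add scale)
  moreover have "0 \<le> L ((1 + c *\<^sub>R y i) * (h * h))" for h
  proof -
    have "(L (h * (y i * h)))\<^sup>2 \<le> L (h * h) * L ((y i * h) * (y i * h))"
      by (rule psd_Cauchy_Schwarz[OF \<open>linear L\<close> psd])
    also have "\<dots> \<le> L (h * h) * L (h * h)"
      using psd_power_bounded_contraction[OF good, of i h] psd[of h]
      by (intro mult_left_mono) (simp_all add: ac_simps)
    finally have "(L (y i * (h * h)))\<^sup>2 \<le> (L (h * h))\<^sup>2"
      by (simp only: power2_eq_square mult.left_commute[of h])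
    then have "\<bar>L (y i * (h * h))\<bar> \<le> L (h * h)"
      using psd[of h] by (simp flip: abs_le_square_iff)
    then have "\<bar>c * L (y i * (h * h))\<bar> \<le> 1 * L (h * h)"
      unfolding abs_mult using c by (intro mult_mono) auto
    then show ?thesis unfolding expand by linarith
  qed
  moreover have "\<exists>C. \<forall>k. \<bar>L ((1 + c *\<^sub>R y i) * (y j ^ k * h))\<bar> \<le> C" for j h
  proof -
    obtain C where "\<And>k. \<bar>L (y j ^ k * ((1 + c *\<^sub>R y i) * h))\<bar> \<le> C"
      using good unfolding psd_power_bounded_def by blast
    then show ?thesis by (auto simp: mult.left_commute intro!: exI[of _ C])
  qed
  ultimately show ?thesis by (simp add: psd_power_bounded_def)
qed

lemma psd_power_bounded_scale:
  assumes "psd_power_bounded y L" "0 \<le> c"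
  shows "psd_power_bounded y (\<lambda>f. c * L f)"
proof -
  from assms have "linear L" by (simp add: psd_power_bounded_def)
  then have "linear (\<lambda>f. c * L f)" by (rule linear_compose_scale_right[of L c, simplified])
  moreover have "\<exists>C. \<forall>k. \<bar>c * L (y i ^ k * h)\<bar> \<le> C" for i h
  proof -
    obtain C where "\<And>k. \<bar>L (y i ^ k * h)\<bar> \<le> C"
      using assms unfolding psd_power_bounded_def by blast
    then have "\<bar>c * L (y i ^ k * h)\<bar> \<le> c * C" for k
      using assms(2) by (simp add: abs_mult mult_left_mono)
    then show ?thesis by blast
  qed
  ultimately show ?thesis using assms by (simp add: psd_power_bounded_def)
qed

text \<open>
  The multipliers that preserve the class form a monoid; each factor belongs to it, so the product
  does, and a functional of the class is nonnegative at \<open>1 = 1 * 1\<close>.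
\<close>

lemma psd_power_bounded_product_nonneg:
  fixes y :: "'n::finite \<Rightarrow> 'a::{comm_ring_1, real_algebra_1}"
  assumes good: "psd_power_bounded y L"
  shows "0 \<le> L (\<Prod>i\<in>UNIV. ((1/2) *\<^sub>R (1 + y i)) ^ a i * ((1/2) *\<^sub>R (1 - y i)) ^ b i)"
proof -
  \<comment> \<open>Quantifying over all functionals of the class makes \<open>S\<close> closed under products.\<close>
  define S where "S = {s. \<forall>L. psd_power_bounded y L \<longrightarrow> psd_power_bounded y (\<lambda>f. L (s * f))}"
  have one: "1 \<in> S" by (simp add: S_def)
  have mult: "s * t \<in> S" if "s \<in> S" "t \<in> S" for s t
  proof -
    have "psd_power_bounded y (\<lambda>f. L (s * t * f))" if "psd_power_bounded y L" for L
    proof -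
      have "psd_power_bounded y (\<lambda>f. L (s * f))" using \<open>s \<in> S\<close> that by (simp add: S_def)
      then have "psd_power_bounded y (\<lambda>f. L (s * (t * f)))"
        using \<open>t \<in> S\<close> unfolding S_def by blast
      then show ?thesis by (simp add: mult.assoc)
    qed
    then show ?thesis by (simp add: S_def)
  qed
  have factor: "(1/2) *\<^sub>R (1 + c *\<^sub>R y i) \<in> S" if c: "\<bar>c\<bar> \<le> 1" for c i
  proof -
    have "psd_power_bounded y (\<lambda>f. L ((1/2) *\<^sub>R (1 + c *\<^sub>R y i) * f))" if "psd_power_bounded y L" for L
    proof -
      from that have "linear L" by (simp add: psd_power_bounded_def)
      then have "L ((1/2) *\<^sub>R (1 + c *\<^sub>R y i) * f) = 1/2 * L ((1 + c *\<^sub>R y i) * f)" for f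
        by (simp add: linear_scale mult_scaleR_left)
      then show ?thesis
        using psd_power_bounded_scale[OF psd_power_bounded_linear_factor[OF that c, of i], of "1/2"]
        by (simp only:)
    qed
    then show ?thesis by (simp add: S_def)
  qed
  have power: "s ^ k \<in> S" if "s \<in> S" for s and k :: nat
    by (induction k) (use that one mult in auto)
  have prod: "(\<Prod>i\<in>I. s i) \<in> S" if "finite I" "\<And>i. s i \<in> S" for s :: "'n \<Rightarrow> 'a" and I
    using that(1) by induction (use that one mult in auto)
  have "(\<Prod>i\<in>UNIV. ((1/2) *\<^sub>R (1 + y i)) ^ a i * ((1/2) *\<^sub>R (1 - y i)) ^ b i) \<in> S"
    using factor[of 1] factor[of "-1"] by (intro prod mult power) auto
  with good have "psd_power_bounded y
      (\<lambda>f. L ((\<Prod>i\<in>UNIV. ((1/2) *\<^sub>R (1 + y i)) ^ a i * ((1/2) *\<^sub>R (1 - y i)) ^ b i) * f))"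
    unfolding S_def by blast
  then have "\<forall>h. 0 \<le> L ((\<Prod>i\<in>UNIV. ((1/2) *\<^sub>R (1 + y i)) ^ a i * ((1/2) *\<^sub>R (1 - y i)) ^ b i) * (h * h))"
    by (simp add: psd_power_bounded_def)
  from this[rule_format, of 1] show ?thesis by simp
qed

section \<open>Bernstein polynomials\<close>

text \<open>
  The Bernstein operator of degree \<open>N\<close> does not reproduce \<open>(k / N) ^ a\<close> exactly, but it does
  reproduce the falling factorial quotient \<open>k (k-1) \<dots> (k-a+1) / (N (N-1) \<dots> (N-a+1))\<close>, here
  written with binomial coefficients. The identity is exact and therefore holds in any commutative
  algebra; analysis enters only through the numerical coefficients.
\<close>

lemma Bernstein_factorial_moment:
  fixes x :: "'a::{comm_ring_1, real_algebra_1}"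
  assumes "a \<le> N"
  shows "(\<Sum>k\<le>N. (real (k choose a) / real (N choose a)) *\<^sub>R (of_nat (N choose k) * x ^ k * (1 - x) ^ (N - k))) = x ^ a"
proof -
  have "(\<Sum>k\<le>N. (real (k choose a) / real (N choose a)) *\<^sub>R (of_nat (N choose k) * x ^ k * (1 - x) ^ (N - k)))
      = (\<Sum>k\<in>{a..N}. (real (k choose a) / real (N choose a)) *\<^sub>R (of_nat (N choose k) * x ^ k * (1 - x) ^ (N - k)))"
    by (rule sum.mono_neutral_right) (auto simp: not_le)
  also have "\<dots> = (\<Sum>k\<in>{a..N}. of_nat ((N - a) choose (k - a)) * x ^ k * (1 - x) ^ (N - k))"
  proof (rule sum.cong[OF refl])
    fix k assume k: "k \<in> {a..N}"
    have "(N choose k) * (k choose a) = (N choose a) * ((N - a) choose (k - a))"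
      using k by (intro choose_mult) auto
    then have "real (k choose a) * real (N choose k) = real (N choose a) * real ((N - a) choose (k - a))"
      by (metis mult.commute of_nat_mult)
    then have "real (k choose a) / real (N choose a) * real (N choose k) = real ((N - a) choose (k - a))"
      using assms by (simp add: field_simps)
    moreover have "of_nat m * z = real m *\<^sub>R z" for m and z :: 'a
      by (metis of_real_of_nat_eq scaleR_conv_of_real)
    ultimately show "(real (k choose a) / real (N choose a)) *\<^sub>R (of_nat (N choose k) * x ^ k * (1 - x) ^ (N - k))
        = of_nat ((N - a) choose (k - a)) * x ^ k * (1 - x) ^ (N - k)"
      by (simp add: mult.assoc)
  qed
  also have "\<dots> = (\<Sum>j\<le>N - a. of_nat ((N - a) choose j) * x ^ (j + a) * (1 - x) ^ (N - a - j))"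
    by (rule sum.reindex_bij_witness[of _ "\<lambda>j. j + a" "\<lambda>k. k - a"]) (use assms in auto)
  also have "\<dots> = x ^ a * (x + (1 - x)) ^ (N - a)"
    unfolding binomial_ring by (simp add: sum_distrib_left power_add ac_simps)
  finally show ?thesis by simp
qed

text \<open>
  Both quantities are products of \<open>a\<close> factors of modulus at most one, and corresponding factors differ
  by at most \<open>a / (N - a)\<close>. The bound does not depend on \<open>k\<close>, which is what makes it usable under
  the sum over all grid points. The hypothesis \<open>2 * a \<le> N\<close> keeps \<open>\<bar>k - j\<bar> \<le> N - j\<close> even when
  \<open>k < j\<close>.
\<close>

lemma choose_ratio_close_to_power:
  assumes k: "k \<le> N" and N: "2 * a \<le> N" "0 < N"
  shows "\<bar>real (k choose a) / real (N choose a) - (real k / real N) ^ a\<bar> \<le> real a * (real a / (real N - real a))"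
proof -
  have ratio: "real (k choose a) / real (N choose a) = (\<Prod>j<a. (real k - real j) / (real N - real j))"
    by (simp add: binomial_gbinomial gbinomial_prod_rev prod_dividef atLeast0LessThan)
  have pos: "real N - real j > 0" if "j < a" for j
    using N that by linarith
  have "norm ((\<Prod>j<a. (real k - real j) / (real N - real j)) - (\<Prod>j<a. real k / real N))
      \<le> (\<Sum>j<a. norm ((real k - real j) / (real N - real j) - real k / real N))"
  proof (rule norm_prod_diff)
    fix j assume j: "j \<in> {..<a}"
    have "\<bar>real k - real j\<bar> \<le> real N - real j" using j N k by auto
    then show "norm ((real k - real j) / (real N - real j)) \<le> 1" using pos[of j] j by simp
    show "norm (real k / real N) \<le> 1" using k N by simp
  qed
  also have "\<dots> \<le> (\<Sum>j<a. real a / (real N - real a))"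
  proof (rule sum_mono)
    fix j assume j: "j \<in> {..<a}"
    have "(real k - real j) / (real N - real j) - real k / real N
        = - ((real j / (real N - real j)) * ((real N - real k) / real N))"
      using pos[of j] j N by (simp add: field_simps)
    then have "norm ((real k - real j) / (real N - real j) - real k / real N)
        = (real j / (real N - real j)) * ((real N - real k) / real N)"
      using pos[of j] j k by simp
    also have "\<dots> \<le> (real a / (real N - real a)) * 1"
      using j k N by (intro mult_mono frac_le) auto
    finally show "norm ((real k - real j) / (real N - real j) - real k / real N) \<le> real a / (real N - real a)"
      by simp
  qed
  finally show ?thesis by (simp add: ratio)
qed

section \<open>A continuous surjection onto the cube\<close>

text \<open>
  Schoenberg's space-filling curve needs a continuous function of period 2 that is 0 on
  \<open>[0, 1/3]\<close> and 1 on \<open>[2/3, 1]\<close>. A truncated cosine has these properties since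
  \<open>cos (\<pi>/3) = 1/2\<close>; on ternary expansions without digit 1 it reads off the first digit (halved).
\<close>

definition ternary_digit :: "real \<Rightarrow> real" where
  "ternary_digit t = max 0 (min 1 (1 / 2 - cos (pi * t)))"

lemma ternary_digit_bounds: "0 \<le> ternary_digit t" "ternary_digit t \<le> 1"
  by (auto simp: ternary_digit_def)

lemma continuous_on_ternary_digit [continuous_intros]:
  fixes f :: "real \<Rightarrow> real"
  shows "continuous_on A f \<Longrightarrow> continuous_on A (\<lambda>t. ternary_digit (f t))"
  unfolding ternary_digit_def by (intro continuous_intros)

lemma ternary_digit_periodic: "ternary_digit (t + 2 * of_int m) = ternary_digit t"
proof -
  have "cos (pi * (t + 2 * of_int m)) = cos (pi * t)"
    using cos.plus_of_int[of "pi * t" m] by (simp add: algebra_simps)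
  then show ?thesis by (simp add: ternary_digit_def)
qed

definition cantor_point :: "(nat \<Rightarrow> bool) \<Rightarrow> real" where
  "cantor_point d = suminf (\<lambda>j. 2 * of_bool (d j) / 3 ^ Suc j)"

lemma cantor_point_sums: "(\<lambda>j. 2 * of_bool (d j) / 3 ^ Suc j) sums cantor_point d"
proof -
  have "summable (\<lambda>j. (1/3::real) ^ j)" by (rule summable_geometric) simp
  then have "summable (\<lambda>j. 2 * of_bool (d j) / 3 ^ Suc j :: real)"
    by (rule summable_comparison_test'[where N = 0]) (auto simp: field_simps)
  then show ?thesis unfolding cantor_point_def by (rule summable_sums)
qed

lemma cantor_point_bounds: "0 \<le> cantor_point d" "cantor_point d \<le> 1"
proof -
  show "0 \<le> cantor_point d"
    by (rule sums_le[OF _ sums_zero cantor_point_sums]) simp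
  have "(\<lambda>j. 2 / 3 * (1/3) ^ j :: real) sums (2 / 3 * (1 / (1 - 1/3)))"
    by (intro sums_mult geometric_sums) simp
  then have "(\<lambda>j. 2 / 3 ^ Suc j :: real) sums 1"
    by (simp add: power_divide)
  then show "cantor_point d \<le> 1"
    by (rule sums_le[OF _ cantor_point_sums, rotated]) simp
qed

lemma cantor_point_shift: "3 * cantor_point d = 2 * of_bool (d 0) + cantor_point (d \<circ> Suc)"
proof -
  have "(\<lambda>j. 3 * (2 * of_bool (d (Suc j)) / 3 ^ Suc (Suc j))) sums (3 * (cantor_point d - 2 * of_bool (d 0) / 3 ^ Suc 0))"
    using cantor_point_sums[of d] by (intro sums_mult) (subst sums_Suc_iff, simp)
  then have "(\<lambda>j. 2 * of_bool ((d \<circ> Suc) j) / 3 ^ Suc j) sums (3 * (cantor_point d - 2 * of_bool (d 0) / 3 ^ Suc 0))"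
    by simp
  then have "3 * (cantor_point d - 2 * of_bool (d 0) / 3 ^ Suc 0) = cantor_point (d \<circ> Suc)"
    by (rule sums_unique2) (rule cantor_point_sums)
  then show ?thesis by simp
qed

text \<open>
  Multiplying by 3 shifts the ternary expansion up to an even integer, which the periodicity of
  \<^const>\<open>ternary_digit\<close> absorbs. This reduces everything to the first digit, which is 2 exactly
  when the point lies in the right third.
\<close>

lemma ternary_digit_cantor_point: "ternary_digit (3 ^ k * cantor_point d) = of_bool (d k)"
proof (induction k arbitrary: d)
  case 0
  let ?t = "cantor_point d"
  have t: "3 * ?t = 2 * of_bool (d 0) + cantor_point (d \<circ> Suc)" by (rule cantor_point_shift)
  show ?case
  proof (cases "d 0")
    case True
    then have "2 / 3 \<le> ?t" "?t \<le> 1" using t cantor_point_bounds[of "d \<circ> Suc"] by auto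
    then have "cos (pi * ?t) \<le> cos (pi * (2 / 3))"
      by (intro cos_monotone_0_pi_le) (auto simp: mult_left_mono)
    also have "\<dots> = - 1 / 2" using cos_120 by (simp add: mult.commute)
    finally show ?thesis using True by (simp add: ternary_digit_def)
  next
    case False
    then have "0 \<le> ?t" "?t \<le> 1 / 3" using t cantor_point_bounds[of "d \<circ> Suc"] cantor_point_bounds[of d] by auto
    then have "cos (pi * (1 / 3)) \<le> cos (pi * ?t)"
      by (intro cos_monotone_0_pi_le) (auto simp: mult_left_mono)
    then have "1 / 2 \<le> cos (pi * ?t)" using cos_60 by simp
    then show ?thesis using False by (simp add: ternary_digit_def)
  qed
next
  case (Suc k)
  have "3 ^ Suc k * cantor_point d
      = 3 ^ k * cantor_point (d \<circ> Suc) + 2 * of_int (3 ^ k * of_bool (d 0))"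
  proof -
    have "3 ^ Suc k * cantor_point d = 3 ^ k * (3 * cantor_point d)" by simp
    then show ?thesis unfolding cantor_point_shift by (simp add: distrib_left del: of_bool_eq_1_iff)
  qed
  then show ?case by (simp only: ternary_digit_periodic Suc) simp
qed

lemma inverse_powers_of_two_sums_1: "(\<lambda>k. 1 / 2 ^ Suc k :: real) sums 1"
proof -
  have "(\<lambda>k. (1/2) * (1/2) ^ k :: real) sums ((1/2) * (1 / (1 - 1/2)))"
    by (intro sums_mult geometric_sums) simp
  then show ?thesis by (simp add: power_divide)
qed

text \<open>
  The differences of the truncations \<open>\<lfloor>2\<^sup>k x\<rfloor> / 2\<^sup>k\<close> are the digits, and the series telescopes. The
  point \<open>x = 1\<close> is separate because its truncations do not start from 0.
\<close>

lemma binary_expansion_exists: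
  assumes "x \<in> {0..1::real}"
  obtains b where "(\<lambda>k. of_bool (b k) / 2 ^ Suc k) sums x"
proof (cases "x = 1")
  case True
  then show ?thesis
    using that[of "\<lambda>_. True"] inverse_powers_of_two_sums_1 by (simp only: of_bool_eq)
next
  case False
  define F where "F k = real_of_int \<lfloor>2 ^ k * x\<rfloor> / 2 ^ k" for k
  define b where "b k \<longleftrightarrow> \<lfloor>2 ^ Suc k * x\<rfloor> \<noteq> 2 * \<lfloor>2 ^ k * x\<rfloor>" for k
  have step: "F (Suc k) - F k = of_bool (b k) / 2 ^ Suc k" for k
  proof -
    have "\<lfloor>2 ^ Suc k * x\<rfloor> = 2 * \<lfloor>2 ^ k * x\<rfloor> \<or> \<lfloor>2 ^ Suc k * x\<rfloor> = 2 * \<lfloor>2 ^ k * x\<rfloor> + 1"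
      using floor_correct[of "2 ^ k * x"] floor_correct[of "2 ^ Suc k * x"]
      by (simp add: mult.assoc) linarith
    then have "real_of_int \<lfloor>2 ^ Suc k * x\<rfloor> = 2 * real_of_int \<lfloor>2 ^ k * x\<rfloor> + of_bool (b k)"
      unfolding b_def by (auto simp del: power_Suc)
    then show ?thesis unfolding F_def by (simp add: field_simps)
  qed
  have "F \<longlonglongrightarrow> x"
  proof (rule LIMSEQ_I)
    have lim: "(\<lambda>k. (1/2::real) ^ k) \<longlonglongrightarrow> 0" by (rule LIMSEQ_realpow_zero) auto
    fix e :: real assume "0 < e"
    from LIMSEQ_D[OF lim this] obtain n where n: "\<forall>k\<ge>n. norm ((1/2::real) ^ k) < e" by auto
    have "norm (F k - x) \<le> (1/2) ^ k" for k
    proof -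
      have "\<bar>real_of_int \<lfloor>2 ^ k * x\<rfloor> - 2 ^ k * x\<bar> \<le> 1"
        using floor_correct[of "2 ^ k * x"] by linarith
      moreover have "F k - x = (real_of_int \<lfloor>2 ^ k * x\<rfloor> - 2 ^ k * x) / 2 ^ k"
        by (simp add: F_def field_simps)
      ultimately show ?thesis by (simp add: power_divide divide_right_mono)
    qed
    moreover have "(1/2::real) ^ k < e" if "n \<le> k" for k using n that by simp
    ultimately show "\<exists>n. \<forall>k\<ge>n. norm (F k - x) < e" using le_less_trans by blast
  qed
  moreover have "F 0 = 0" using assms False by (simp add: F_def floor_eq_iff)
  ultimately have "(\<lambda>k. of_bool (b k) / 2 ^ Suc k) sums x"
    using telescope_sums[of F x] by (simp add: step del: power_Suc)
  then show ?thesis by (rule that)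
qed

lemma continuous_on_suminf_dominated:
  fixes f :: "nat \<Rightarrow> 'a::topological_space \<Rightarrow> real"
  assumes "\<And>k. continuous_on A (f k)" "\<And>k x. x \<in> A \<Longrightarrow> \<bar>f k x\<bar> \<le> M k" "summable M"
  shows "continuous_on A (\<lambda>x. suminf (\<lambda>k. f k x))"
proof (rule uniform_limit_theorem)
  show "uniform_limit A (\<lambda>n x. \<Sum>k<n. f k x) (\<lambda>x. suminf (\<lambda>k. f k x)) sequentially"
    using assms(2,3) by (intro Weierstrass_m_test) auto
  show "\<forall>\<^sub>F n in sequentially. continuous_on A (\<lambda>x. \<Sum>k<n. f k x)"
    using assms(1) by (intro always_eventually allI continuous_on_sum) auto
qed simp

text \<open>
  The parameter carries one binary expansion for each coordinate; \<^const>\<open>to_nat\<close> distributes the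
  ternary positions among the pairs of a coordinate and a binary position.
\<close>

definition schoenberg_curve :: "real \<Rightarrow> real ^ 'n::finite" where
  "schoenberg_curve t = (\<chi> i. suminf (\<lambda>k. ternary_digit (3 ^ to_nat (i, k) * t) / 2 ^ Suc k))"

lemma schoenberg_curve_in_cube: "schoenberg_curve t $ i \<in> {0..1}"
proof -
  let ?f = "\<lambda>k. ternary_digit (3 ^ to_nat (i, k) * t) / 2 ^ Suc k"
  have le: "0 \<le> ?f k" "?f k \<le> 1 / 2 ^ Suc k" for k
    using ternary_digit_bounds by (auto intro!: divide_right_mono)
  have "summable ?f"
  proof (rule summable_comparison_test'[OF sums_summable[OF inverse_powers_of_two_sums_1]])
    show "norm (?f k) \<le> 1 / 2 ^ Suc k" for k
      unfolding real_norm_def abs_of_nonneg[OF le(1)] by (rule le)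
  qed
  then have "?f sums (schoenberg_curve t $ i)"
    by (simp add: schoenberg_curve_def summable_sums)
  from sums_le[OF le(1) sums_zero this] sums_le[OF le(2) this inverse_powers_of_two_sums_1]
  show ?thesis by simp
qed

lemma continuous_on_schoenberg_curve: "continuous_on A (schoenberg_curve :: real \<Rightarrow> real ^ 'n::finite)"
proof -
  have "continuous_on A (\<lambda>t. suminf (\<lambda>k. ternary_digit (3 ^ to_nat (i, k) * t) / 2 ^ Suc k))" for i :: 'n
  proof (rule continuous_on_suminf_dominated[OF _ _ sums_summable[OF inverse_powers_of_two_sums_1]])
    show "continuous_on A (\<lambda>t. ternary_digit (3 ^ to_nat (i, k) * t) / 2 ^ Suc k)" for k
      by (intro continuous_intros) simp
    show "\<bar>ternary_digit (3 ^ to_nat (i, k) * t) / 2 ^ Suc k\<bar> \<le> 1 / 2 ^ Suc k" for k t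
      using ternary_digit_bounds by (auto intro!: divide_right_mono)
  qed
  then show ?thesis unfolding schoenberg_curve_def by (rule continuous_on_vec_lambda)
qed

lemma schoenberg_curve_onto_cube:
  fixes x :: "real ^ 'n::finite"
  assumes "\<And>i. x $ i \<in> {0..1}"
  obtains t where "t \<in> {0..1}" "schoenberg_curve t = x"
proof -
  define b where "b i = (SOME b. (\<lambda>k. of_bool (b k) / 2 ^ Suc k) sums (x $ i))" for i
  have b: "(\<lambda>k. of_bool (b i k) / 2 ^ Suc k) sums (x $ i)" for i
  proof -
    have "\<exists>b. (\<lambda>k. of_bool (b k) / 2 ^ Suc k) sums (x $ i)"
      using binary_expansion_exists[OF assms[of i]] by blast
    then show ?thesis unfolding b_def by (rule someI_ex)
  qed
  \<comment> \<open>Position \<open>to_nat (i, k)\<close> holds the \<open>k\<close>-th digit of coordinate \<open>i\<close>.\<close>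
  define d where "d j = (case from_nat j of (i, k) \<Rightarrow> b i k)" for j
  have "schoenberg_curve (cantor_point d) $ i = x $ i" for i
    unfolding schoenberg_curve_def
    by (simp add: ternary_digit_cantor_point d_def sums_unique[OF b, symmetric] del: power_Suc)
  then have "schoenberg_curve (cantor_point d) = x" by (simp add: vec_eq_iff)
  then show ?thesis using that cantor_point_bounds[of d] by auto
qed

section \<open>Weak compactness of probability measures on the cube\<close>

text \<open>
  Helly's selection theorem is about measures on the line. A section of the space-filling curve
  lifts the discrete measures to the unit interval, where the lifts are tight; their weak limit is
  pushed forward along the curve. The section is merely set-theoretic, which suffices because the
  lifted measures are discrete, whereas the curve itself is continuous, so that test functions on
  the cube become bounded continuous functions on the line.
\<close>

lemma discrete_measures_on_cube_convergent_subsequence: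
  fixes A :: "nat \<Rightarrow> 'b set" and x :: "nat \<Rightarrow> 'b \<Rightarrow> real ^ 'n::finite"
  assumes fin: "\<And>N. finite (A N)" and nonneg: "\<And>N k. k \<in> A N \<Longrightarrow> 0 \<le> w N k"
    and total: "\<And>N. (\<Sum>k\<in>A N. w N k) = 1"
    and cube: "\<And>N k i. k \<in> A N \<Longrightarrow> x N k $ i \<in> {0..1}"
  obtains \<mu> s where "prob_space \<mu>" "sets \<mu> = sets borel" "strict_mono (s :: nat \<Rightarrow> nat)"
    "AE y in \<mu>. \<forall>i. y $ i \<in> {0..1}"
    "\<And>f :: real ^ 'n \<Rightarrow> real. continuous_on UNIV f \<Longrightarrow>
       (\<lambda>j. \<Sum>k\<in>A (s j). w (s j) k * f (x (s j) k)) \<longlonglongrightarrow> (\<integral>y. f y \<partial>\<mu>)"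
proof -
  define t where "t N k = (SOME t. t \<in> {0..1} \<and> schoenberg_curve t = x N k)" for N k
  have "t N k \<in> {0..1} \<and> schoenberg_curve (t N k) = x N k" if k: "k \<in> A N" for N k
  proof -
    obtain u where "u \<in> {0..1} \<and> schoenberg_curve u = x N k"
      using schoenberg_curve_onto_cube[of "x N k"] cube[OF k] by blast
    then show ?thesis unfolding t_def by (rule someI)
  qed
  then have t: "t N k \<in> {0..1}" "schoenberg_curve (t N k) = x N k" if "k \<in> A N" for N k
    using that by auto
  define P where "P N = point_measure (A N) (w N)" for N
  define Q where "Q N = distr (P N) borel (t N)" for N
  have P: "prob_space (P N)" for N
    unfolding P_def using fin nonneg total by (intro prob_space_point_measure) auto
  have meas[measurable]: "t N \<in> measurable (P N) borel" for N
    by (simp add: P_def)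
  have Q: "real_distribution (Q N)" for N
  proof -
    interpret prob_space "P N" by (rule P)
    interpret Q: prob_space "Q N" unfolding Q_def by (rule prob_space_distr) (rule meas)
    show ?thesis by unfold_locales (simp_all add: Q_def)
  qed
  have "tight Q"
    unfolding tight_def
  proof (intro conjI allI impI)
    show "real_distribution (Q N)" for N by (rule Q)
    fix e :: real assume "0 < e"
    have "measure (Q N) {-1<..1} = 1" for N
    proof -
      have "t N -` {-1<..1} \<inter> space (P N) = space (P N)"
        using t(1) by (force simp: P_def space_point_measure)
      then show ?thesis
        unfolding Q_def by (simp add: measure_distr prob_space.prob_space[OF P])
    qed
    then show "\<exists>a b. a < b \<and> (\<forall>n. 1 - e < measure (Q n) {a<..b})"
      using \<open>0 < e\<close> by (intro exI[of _ "-1"] exI[of _ 1]) auto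
  qed
  from tight_imp_convergent_subsubsequence[OF this strict_mono_id]
  obtain s M where s: "strict_mono s" and M: "real_distribution M" and conv: "weak_conv_m (Q \<circ> s) M"
    by (auto simp: comp_def)
  interpret M: real_distribution M by (rule M)
  have cont: "continuous_on UNIV (schoenberg_curve :: real \<Rightarrow> real ^ 'n)"
    by (rule continuous_on_schoenberg_curve)
  have [measurable]: "(schoenberg_curve :: real \<Rightarrow> real ^ 'n) \<in> measurable M borel"
    using borel_measurable_continuous_onI[OF cont] by simp
  define \<mu> where "\<mu> = distr M borel (schoenberg_curve :: real \<Rightarrow> real ^ 'n)"
  show ?thesis
  proof (rule that[OF _ _ s])
    show "prob_space \<mu>" unfolding \<mu>_def by (rule M.prob_space_distr) simp
    show "sets \<mu> = sets borel" by (simp add: \<mu>_def)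
    show "AE y in \<mu>. \<forall>i. y $ i \<in> {0..1}"
      unfolding \<mu>_def using schoenberg_curve_in_cube by (subst AE_distr_iff) auto
    fix f :: "real ^ 'n \<Rightarrow> real" assume f: "continuous_on UNIV f"
    have fm[measurable]: "f \<in> borel_measurable borel" by (rule borel_measurable_continuous_onI[OF f])
    let ?g = "\<lambda>u. f (schoenberg_curve u)"
    have g: "continuous_on UNIV ?g"
      using continuous_on_compose2[OF f cont] by simp
    have "compact (f ` cbox 0 1)"
      by (intro compact_continuous_image continuous_on_subset[OF f]) auto
    then obtain B where B: "\<And>y. y \<in> cbox 0 1 \<Longrightarrow> norm (f y) \<le> B"
      using compact_imp_bounded[of "f ` cbox 0 1"] unfolding bounded_iff by blast
    have "norm (?g u) \<le> B" for u
      using schoenberg_curve_in_cube[of u] by (intro B) (auto simp: mem_box_cart)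
    moreover have "isCont ?g u" for u using g continuous_on_eq_continuous_at by blast
    moreover have "real_distribution ((Q \<circ> s) j)" for j using Q by simp
    ultimately have lim: "(\<lambda>j. integral\<^sup>L ((Q \<circ> s) j) ?g) \<longlonglongrightarrow> integral\<^sup>L M ?g"
      using conv M by (intro weak_conv_imp_integral_bdd_continuous_conv) (auto simp: comp_def)
    have gm[measurable]: "?g \<in> borel_measurable borel" by (rule borel_measurable_continuous_onI[OF g])
    have "integral\<^sup>L (Q N) ?g = (\<Sum>k\<in>A N. w N k * f (x N k))" for N
    proof -
      have "integral\<^sup>L (Q N) ?g = integral\<^sup>L (P N) (\<lambda>k. ?g (t N k))"
        unfolding Q_def by (rule integral_distr) simp_all
      also have "\<dots> = (\<Sum>k\<in>A N. w N k * f (x N k))"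
        unfolding P_def using fin nonneg t(2) by (simp add: lebesgue_integral_point_measure_finite)
      finally show ?thesis .
    qed
    moreover have "integral\<^sup>L \<mu> f = integral\<^sup>L M ?g"
      unfolding \<mu>_def by (rule integral_distr) simp_all
    ultimately show "(\<lambda>j. \<Sum>k\<in>A (s j). w (s j) k * f (x (s j) k)) \<longlonglongrightarrow> (\<integral>y. f y \<partial>\<mu>)"
      using lim by simp
  qed
qed

section \<open>Functionals that are positive on the Bernstein basis\<close>

lemma prod_scaleR_distrib:
  fixes f :: "'i \<Rightarrow> 'a::{comm_ring_1, real_algebra_1}"
  shows "(\<Prod>i\<in>I. c i *\<^sub>R f i) = (\<Prod>i\<in>I. c i) *\<^sub>R (\<Prod>i\<in>I. f i)"
  by (induction I rule: infinite_finite_induct) simp_all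

text \<open>
  This is the multidimensional Hausdorff moment problem, stated in an arbitrary commutative algebra.
  The values of \<open>L\<close> on the Bernstein basis of degree \<open>N\<close> are nonnegative weights with sum \<open>L 1\<close>;
  placed at the grid points \<open>p / N\<close> they form discrete measures on the cube. By
  \<open>Bernstein_factorial_moment\<close> the value of \<open>L\<close> at a monomial is a factorial moment of these
  measures, which differs from the ordinary moment by an error that tends to 0; a weak limit point
  therefore has exactly the required moments.
\<close>

lemma positive_on_Bernstein_imp_moments:
  fixes L :: "'a::{comm_ring_1, real_algebra_1} \<Rightarrow> real" and u :: "'n::finite \<Rightarrow> 'a"
  assumes L: "linear L"
    and nonneg: "\<And>a b. 0 \<le> L (\<Prod>i\<in>UNIV. u i ^ a i * (1 - u i) ^ b i)"
  obtains \<mu> :: "(real ^ 'n) measure" where "finite_measure \<mu>" "sets \<mu> = sets borel"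
    "AE y in \<mu>. \<forall>i. y $ i \<in> {0..1}"
    "\<And>\<alpha>. L (\<Prod>i\<in>UNIV. u i ^ \<alpha> i) = (\<integral>y. (\<Prod>i\<in>UNIV. (y $ i) ^ \<alpha> i) \<partial>\<mu>)"
proof -
  interpret linear L by (rule L)
  define A where "A N = (UNIV :: 'n set) \<rightarrow>\<^sub>E {..N::nat}" for N
  define B where "B N k z = of_nat (N choose k) * z ^ k * (1 - z) ^ (N - k)" for N k and z :: 'a
  define w where "w N p = L (\<Prod>i\<in>UNIV. B N (p i) (u i))" for N p
  define c where "c N a k = real (k choose a) / real (N choose a)" for N a k
  have fin: "finite (A N)" for N
    by (simp add: A_def finite_PiE)
  have w_nonneg: "0 \<le> w N p" for N p
  proof -
    have "B N k z = real (N choose k) *\<^sub>R (z ^ k * (1 - z) ^ (N - k))" for k z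
      by (simp add: B_def mult.assoc scaleR_conv_of_real)
    then have "w N p = (\<Prod>i\<in>UNIV. real (N choose p i)) * L (\<Prod>i\<in>UNIV. u i ^ p i * (1 - u i) ^ (N - p i))"
      by (simp add: w_def prod_scaleR_distrib scale)
    then show ?thesis
      using nonneg[of p "\<lambda>i. N - p i"] by (simp add: prod_nonneg)
  qed
  have expansion: "L (\<Prod>i\<in>UNIV. u i ^ \<alpha> i) = (\<Sum>p\<in>A N. w N p * (\<Prod>i\<in>UNIV. c N (\<alpha> i) (p i)))"
    if "\<And>i. \<alpha> i \<le> N" for \<alpha> N
  proof -
    have "(\<Prod>i\<in>UNIV. u i ^ \<alpha> i) = (\<Prod>i\<in>UNIV. \<Sum>k\<le>N. c N (\<alpha> i) k *\<^sub>R B N k (u i))"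
      unfolding c_def B_def using that by (simp only: Bernstein_factorial_moment)
    also have "\<dots> = (\<Sum>p\<in>A N. (\<Prod>i\<in>UNIV. c N (\<alpha> i) (p i)) *\<^sub>R (\<Prod>i\<in>UNIV. B N (p i) (u i)))"
      unfolding A_def by (subst prod_sum_PiE) (simp_all add: prod_scaleR_distrib)
    finally show ?thesis
      by (simp add: sum scale w_def mult.commute)
  qed
  have total: "(\<Sum>p\<in>A N. w N p) = L 1" for N
    using expansion[of "\<lambda>_. 0" N] by (simp add: c_def)
  have L1: "0 \<le> L 1" using nonneg[of "\<lambda>_. 0" "\<lambda>_. 0"] by simp
  show ?thesis
  proof (cases "L 1 = 0")
    case True
    \<comment> \<open>In the degenerate case all weights vanish and the null measure works.\<close>
    have zero: "w N p = 0" if "p \<in> A N" for N p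
      using total[of N] True fin that by (simp add: sum_nonneg_eq_0_iff w_nonneg)
    have "L (\<Prod>i\<in>UNIV. u i ^ \<alpha> i) = 0" for \<alpha>
      using expansion[of \<alpha> "Max (range \<alpha>)"] zero by simp
    moreover have "finite_measure (null_measure (borel :: (real ^ 'n) measure))"
      by (rule finite_measureI) simp
    ultimately show ?thesis
      by (intro that[of "null_measure borel"]) (auto simp: AE_iff_null null_sets_def)
  next
    case False
    then have L1: "0 < L 1" using L1 by simp
    obtain \<nu> s where \<nu>: "prob_space \<nu>" "sets \<nu> = sets borel" and s: "strict_mono (s :: nat \<Rightarrow> nat)"
      and cube: "AE y in \<nu>. \<forall>i. y $ i \<in> {0..1}"
      and conv: "\<And>f :: real ^ 'n \<Rightarrow> real. continuous_on UNIV f \<Longrightarrow>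
        (\<lambda>j. \<Sum>p\<in>A (s j). w (s j) p / L 1 * f (\<chi> i. real (p i) / real (s j))) \<longlonglongrightarrow> (\<integral>y. f y \<partial>\<nu>)"
    proof (rule discrete_measures_on_cube_convergent_subsequence
        [where A = A and w = "\<lambda>N p. w N p / L 1" and x = "\<lambda>N p. \<chi> i. real (p i) / real N"])
      show "finite (A N)" for N by (rule fin)
      show "0 \<le> w N p / L 1" for N p using w_nonneg L1 by simp
      show "(\<Sum>p\<in>A N. w N p / L 1) = 1" for N
        using total[of N] L1 by (simp flip: sum_divide_distrib)
      show "(\<chi> i. real (p i) / real N) $ i \<in> {0..1}" if "p \<in> A N" for N p i
      proof -
        have "p i \<le> N" using that by (auto simp: A_def)
        then show ?thesis by (auto simp: divide_le_eq_1)
      qed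
    qed blast
    interpret \<nu>: prob_space \<nu> by (rule \<nu>)
    \<comment> \<open>Undo the normalisation to total mass one.\<close>
    define \<mu> where "\<mu> = density \<nu> (\<lambda>_. ennreal (L 1))"
    have moment: "L (\<Prod>i\<in>UNIV. u i ^ \<alpha> i) = L 1 * (\<integral>y. (\<Prod>i\<in>UNIV. (y $ i) ^ \<alpha> i) \<partial>\<nu>)" for \<alpha>
    proof -
      define g where "g N = (\<Sum>p\<in>A N. w N p / L 1 * (\<Prod>i\<in>UNIV. (real (p i) / real N) ^ \<alpha> i))" for N
      define e where "e N = (\<Sum>i\<in>UNIV. real (\<alpha> i) * (real (\<alpha> i) / (real N - real (\<alpha> i))))" for N
      have "continuous_on UNIV (\<lambda>y :: real ^ 'n. \<Prod>i\<in>UNIV. (y $ i) ^ \<alpha> i)"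
        by (intro continuous_intros)
      from conv[OF this] have lim: "(\<lambda>j. g (s j)) \<longlonglongrightarrow> (\<integral>y. (\<Prod>i\<in>UNIV. (y $ i) ^ \<alpha> i) \<partial>\<nu>)"
        by (simp add: g_def)
      have close: "norm (g N - L (\<Prod>i\<in>UNIV. u i ^ \<alpha> i) / L 1) \<le> e N" if N: "N \<ge> Suc (2 * Max (range \<alpha>))" for N
      proof -
        have le: "2 * \<alpha> i \<le> N" "0 < N" for i
        proof -
          have "\<alpha> i \<le> Max (range \<alpha>)" by (rule Max_ge) auto
          then show "2 * \<alpha> i \<le> N" "0 < N" using N by linarith+
        qed
        have diff: "\<bar>(\<Prod>i\<in>UNIV. (real (p i) / real N) ^ \<alpha> i) - (\<Prod>i\<in>UNIV. c N (\<alpha> i) (p i))\<bar> \<le> e N"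
          if "p \<in> A N" for p
        proof -
          have p: "p i \<le> N" for i using that by (auto simp: A_def)
          have "norm ((\<Prod>i\<in>UNIV. (real (p i) / real N) ^ \<alpha> i) - (\<Prod>i\<in>UNIV. c N (\<alpha> i) (p i)))
              \<le> (\<Sum>i\<in>UNIV. norm ((real (p i) / real N) ^ \<alpha> i - c N (\<alpha> i) (p i)))"
          proof (rule norm_prod_diff)
            fix i
            show "norm ((real (p i) / real N) ^ \<alpha> i) \<le> 1"
              using p[of i] le(1)[of i] le(2) by (simp add: power_le_one)
            have "(p i choose \<alpha> i) \<le> (N choose \<alpha> i)" by (rule binomial_right_mono) (rule p)
            then show "norm (c N (\<alpha> i) (p i)) \<le> 1"
              using le(1)[of i] le(2) by (simp add: c_def)
          qed
          also have "\<dots> \<le> e N"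
            unfolding e_def
          proof (rule sum_mono)
            fix i
            show "norm ((real (p i) / real N) ^ \<alpha> i - c N (\<alpha> i) (p i)) \<le> real (\<alpha> i) * (real (\<alpha> i) / (real N - real (\<alpha> i)))"
              unfolding real_norm_def c_def abs_minus_commute[of "(real (p i) / real N) ^ \<alpha> i"]
              using p le(1) le(2) by (rule choose_ratio_close_to_power)
          qed
          finally show ?thesis by simp
        qed
        have "\<alpha> i \<le> N" for i using le(1)[of i] le(2) by simp
        then have "g N - L (\<Prod>i\<in>UNIV. u i ^ \<alpha> i) / L 1
            = (\<Sum>p\<in>A N. w N p / L 1 * ((\<Prod>i\<in>UNIV. (real (p i) / real N) ^ \<alpha> i) - (\<Prod>i\<in>UNIV. c N (\<alpha> i) (p i))))"
          by (simp add: expansion[of \<alpha> N] g_def sum_divide_distrib right_diff_distrib sum_subtractf)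
        also have "norm \<dots> \<le> (\<Sum>p\<in>A N. w N p / L 1 * e N)"
        proof (rule sum_norm_le)
          fix p assume "p \<in> A N"
          then show "norm (w N p / L 1 * ((\<Prod>i\<in>UNIV. (real (p i) / real N) ^ \<alpha> i) - (\<Prod>i\<in>UNIV. c N (\<alpha> i) (p i))))
              \<le> w N p / L 1 * e N"
            unfolding norm_mult using w_nonneg[of N p] L1 diff[of p] by (simp add: mult_left_mono divide_right_mono)
        qed
        also have "\<dots> = e N"
          using total[of N] L1 by (simp flip: sum_distrib_right sum_divide_distrib)
        finally show ?thesis .
      qed
      have "(\<lambda>N. real a * (real a / (real N - real a))) \<longlonglongrightarrow> 0" for a
        by real_asymp
      then have "e \<longlonglongrightarrow> (\<Sum>i\<in>(UNIV :: 'n set). 0)"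
        unfolding e_def by (intro tendsto_sum)
      then have "e \<longlonglongrightarrow> 0" by simp
      then have "(\<lambda>N. g N - L (\<Prod>i\<in>UNIV. u i ^ \<alpha> i) / L 1) \<longlonglongrightarrow> 0"
        by (rule Lim_null_comparison[rotated]) (rule eventually_sequentiallyI[OF close])
      then have "g \<longlonglongrightarrow> L (\<Prod>i\<in>UNIV. u i ^ \<alpha> i) / L 1"
        by (simp add: LIM_zero_iff)
      then have "(\<lambda>j. g (s j)) \<longlonglongrightarrow> L (\<Prod>i\<in>UNIV. u i ^ \<alpha> i) / L 1"
        using LIMSEQ_subseq_LIMSEQ[OF _ s] by (simp add: comp_def)
      from LIMSEQ_unique[OF this lim] show ?thesis using L1 by (simp add: field_simps)
    qed
    show ?thesis
    proof (rule that)
      show "finite_measure \<mu>"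
        by (rule finite_measureI)
          (simp add: \<mu>_def emeasure_density nn_integral_cmult_indicator ennreal_mult_eq_top_iff)
      show "sets \<mu> = sets borel" by (simp add: \<mu>_def \<nu>)
      show "AE y in \<mu>. \<forall>i. y $ i \<in> {0..1}"
        unfolding \<mu>_def using cube by (simp add: AE_density)
      have [measurable_cong]: "sets \<nu> = sets borel" by (rule \<nu>)
      show "L (\<Prod>i\<in>UNIV. u i ^ \<alpha> i) = (\<integral>y. (\<Prod>i\<in>UNIV. (y $ i) ^ \<alpha> i) \<partial>\<mu>)" for \<alpha>
      proof -
        have "(\<lambda>y. \<Prod>i\<in>UNIV. (y $ i) ^ \<alpha> i) \<in> borel_measurable \<nu>"
          by measurable
        then show ?thesis
          unfolding moment \<mu>_def using L1 by (subst integral_density) simp_all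
      qed
    qed
  qed
qed

section \<open>Polynomials as a real algebra\<close>

lemma lookup_scaleR:
  "Poly_Mapping.lookup (c *\<^sub>R f) k = c *\<^sub>R Poly_Mapping.lookup f k"
proof -
  have "finite {i. c *\<^sub>R Poly_Mapping.lookup f i \<noteq> 0}"
    by (rule finite_subset[OF _ finite_keys[of f]]) (auto simp: in_keys_iff)
  then show ?thesis
    by (simp add: scaleR_poly_mapping_def Abs_poly_mapping_inverse)
qed

text \<open>
  The scalar multiplication of finitely supported families is compatible with the convolution
  product because it is multiplication by a constant polynomial.
\<close>

instance poly_mapping :: (comm_monoid_add, "{real_algebra_1, comm_ring_1}") real_algebra_1
proof
  fix c :: real and f g :: "'a \<Rightarrow>\<^sub>0 'b"
  have scale: "c *\<^sub>R h = Poly_Mapping.single 0 (of_real c) * h" for h :: "'a \<Rightarrow>\<^sub>0 'b"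
  proof (rule poly_mapping_eqI)
    fix k
    have "Poly_Mapping.lookup (Poly_Mapping.map ((*) (of_real c)) h) k = of_real c * Poly_Mapping.lookup h k"
      by (simp add: Poly_Mapping.map.rep_eq when_def)
    then show "Poly_Mapping.lookup (c *\<^sub>R h) k = Poly_Mapping.lookup (Poly_Mapping.single 0 (of_real c) * h) k"
      by (simp only: lookup_scaleR scaleR_conv_of_real mult_map_scale_conv_mult)
  qed
  show "c *\<^sub>R f * g = c *\<^sub>R (f * g)" by (simp only: scale mult.assoc)
  show "f * c *\<^sub>R g = c *\<^sub>R (f * g)" by (simp only: scale mult.left_commute)
qed

lemma monomial_add: "monomial (\<alpha> + \<beta>) = monomial \<alpha> * monomial \<beta>"
  by (simp add: monomial_def mult_single)

lemma monomial_0: "monomial 0 = 1"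
  by (simp add: monomial_def)

text \<open>
  Every polynomial is a linear combination of monomials, so a property that is stable under linear
  combinations need only be checked on monomials.
\<close>

lemma real_mpoly_induct [case_names monomial add scale]:
  assumes monomial: "\<And>\<alpha>. P (monomial \<alpha>)"
    and add: "\<And>f g. P f \<Longrightarrow> P g \<Longrightarrow> P (f + g)"
    and scale: "\<And>c f. P f \<Longrightarrow> P (c *\<^sub>R f)"
  shows "P (f :: 'n real_mpoly)"
proof -
  have f: "f = (\<Sum>\<alpha>\<in>Poly_Mapping.keys f. Poly_Mapping.lookup f \<alpha> *\<^sub>R monomial \<alpha>)"
    by (rule poly_mapping_eqI)
      (simp add: lookup_sum lookup_scaleR monomial_def lookup_single when_def in_keys_iff if_distrib[of "(*) _"] cong: if_cong)
  have zero: "P 0" using scale[OF monomial, of 0] by simp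
  have "P (\<Sum>\<alpha>\<in>S. Poly_Mapping.lookup f \<alpha> *\<^sub>R monomial \<alpha>)" if "finite S" for S
    using that
  proof (induction S rule: finite_induct)
    case empty
    show ?case using zero by simp
  next
    case (insert \<alpha> S)
    show ?case
      unfolding sum.insert[OF insert.hyps(1,2)] by (intro add scale monomial insert.IH)
  qed
  then have "P (\<Sum>\<alpha>\<in>Poly_Mapping.keys f. Poly_Mapping.lookup f \<alpha> *\<^sub>R monomial \<alpha>)" by simp
  then show ?thesis by (simp only: f[symmetric])
qed

lemma mpoly_eval_linear: "linear (\<lambda>f. mpoly_eval f x)"
proof (rule linearI)
  have superset: "mpoly_eval f x = (\<Sum>\<alpha>\<in>S. Poly_Mapping.lookup f \<alpha> * (\<Prod>i\<in>UNIV. (x $ i) ^ Poly_Mapping.lookup \<alpha> i))"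
    if "finite S" "Poly_Mapping.keys f \<subseteq> S" for f :: "'a real_mpoly" and S
    unfolding mpoly_eval_def using that by (intro sum.mono_neutral_left) (auto simp: in_keys_iff)
  fix f g :: "'a real_mpoly" and c :: real
  let ?S = "Poly_Mapping.keys f \<union> Poly_Mapping.keys g"
  have "Poly_Mapping.keys (f + g) \<subseteq> ?S" by (rule keys_add)
  then show "mpoly_eval (f + g) x = mpoly_eval f x + mpoly_eval g x"
    by (simp add: superset[of ?S] lookup_add distrib_right sum.distrib)
  have "Poly_Mapping.keys (c *\<^sub>R f) \<subseteq> Poly_Mapping.keys f" by (auto simp: in_keys_iff lookup_scaleR)
  then show "mpoly_eval (c *\<^sub>R f) x = c *\<^sub>R mpoly_eval f x"
    by (simp add: superset[of "Poly_Mapping.keys f"] lookup_scaleR sum_distrib_left mult.assoc)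
qed

lemmas mpoly_eval_add = linear_add[OF mpoly_eval_linear]
lemmas mpoly_eval_scaleR = linear_scale[OF mpoly_eval_linear]

lemma mpoly_eval_monomial: "mpoly_eval (monomial \<alpha>) x = (\<Prod>i\<in>UNIV. (x $ i) ^ Poly_Mapping.lookup \<alpha> i)"
  by (simp add: mpoly_eval_def monomial_def)

lemma mpoly_eval_1: "mpoly_eval 1 x = 1"
  using mpoly_eval_monomial[of 0 x] by (simp add: monomial_0)

lemma mpoly_eval_mult: "mpoly_eval (f * g) x = mpoly_eval f x * mpoly_eval g x"
proof (induction f rule: real_mpoly_induct)
  case (monomial \<alpha>)
  show ?case
  proof (induction g rule: real_mpoly_induct)
    case (monomial \<beta>)
    show ?case
      by (simp add: mpoly_eval_monomial lookup_add power_add prod.distrib flip: monomial_add)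
  qed (simp_all add: mpoly_eval_add mpoly_eval_scaleR distrib_left)
qed (simp_all add: mpoly_eval_add mpoly_eval_scaleR distrib_right)

lemma mpoly_eval_power: "mpoly_eval (f ^ k) x = mpoly_eval f x ^ k"
  by (induction k) (simp_all add: mpoly_eval_1 mpoly_eval_mult)

lemma mpoly_eval_prod: "mpoly_eval (\<Prod>i\<in>I. f i) x = (\<Prod>i\<in>I. mpoly_eval (f i) x)"
  by (induction I rule: infinite_finite_induct) (simp_all add: mpoly_eval_1 mpoly_eval_mult)

lemma continuous_on_mpoly_eval: "continuous_on A (mpoly_eval f)"
  unfolding mpoly_eval_def by (intro continuous_intros)

definition mpoly_var :: "'n \<Rightarrow> 'n real_mpoly" where
  "mpoly_var i = monomial (Poly_Mapping.single i 1)"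

lemma mpoly_eval_var: "mpoly_eval (mpoly_var i) x = x $ i"
proof -
  have "(\<Prod>j\<in>UNIV. (x $ j) ^ Poly_Mapping.lookup (Poly_Mapping.single i 1) j) = (\<Prod>j\<in>UNIV. if j = i then x $ i else 1)"
    by (rule prod.cong) (auto simp: lookup_single when_def)
  then show ?thesis by (simp add: mpoly_var_def mpoly_eval_monomial)
qed

lemma mpoly_var_power: "mpoly_var i ^ k = monomial (Poly_Mapping.single i k)"
proof (induction k)
  case (Suc k)
  have "mpoly_var i ^ Suc k = monomial (Poly_Mapping.single i 1 + Poly_Mapping.single i k)"
    by (simp only: power_Suc Suc monomial_add) (simp only: mpoly_var_def)
  also have "Poly_Mapping.single i 1 + Poly_Mapping.single i k = Poly_Mapping.single i (Suc k)"
    by (simp flip: single_add)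
  finally show ?case .
qed (simp add: monomial_0)

lemma monomial_eq_prod_var:
  fixes \<alpha> :: "'n::finite multi_index"
  shows "monomial \<alpha> = (\<Prod>i\<in>UNIV. mpoly_var i ^ Poly_Mapping.lookup \<alpha> i)"
proof -
  have "(\<Prod>i\<in>I. monomial (g i)) = monomial (\<Sum>i\<in>I. g i)" for I and g :: "'n \<Rightarrow> 'n multi_index"
    by (induction I rule: infinite_finite_induct) (simp_all add: monomial_0 monomial_add)
  moreover have "(\<Sum>i\<in>UNIV. Poly_Mapping.single i (Poly_Mapping.lookup \<alpha> i)) = \<alpha>"
    by (rule poly_mapping_eqI) (simp add: lookup_sum lookup_single when_def)
  ultimately show ?thesis by (simp add: mpoly_var_power)
qed

text \<open>
  An affine change of variables does not change the ring of polynomials: the span of the products of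
  powers of the new variables contains 1 and is stable under multiplication by each new, hence by
  each old, variable.
\<close>

lemma span_affine_monomials:
  fixes u :: "'n::finite \<Rightarrow> 'n real_mpoly"
  assumes var: "\<And>i. \<exists>c d. mpoly_var i = c *\<^sub>R u i + d *\<^sub>R 1"
  shows "f \<in> span (range (\<lambda>a. \<Prod>i\<in>UNIV. u i ^ a i))"
proof -
  let ?V = "span (range (\<lambda>a. \<Prod>i\<in>UNIV. u i ^ a i))"
  have mult_u: "u i * f \<in> ?V" if "f \<in> ?V" for f i
    using that
  proof (induction rule: span_induct_alt)
    case (step c x y)
    then obtain a where x: "x = (\<Prod>i\<in>UNIV. u i ^ a i)" by blast
    have "(\<Prod>j\<in>UNIV. u j ^ (a(i := Suc (a i))) j) = u i ^ Suc (a i) * (\<Prod>j\<in>UNIV - {i}. u j ^ a j)"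
      by (subst prod.remove[of UNIV i]) (auto intro!: prod.cong)
    also have "\<dots> = u i * x"
      unfolding x by (subst prod.remove[of UNIV i "\<lambda>j. u j ^ a j"]) (simp_all add: mult.assoc)
    finally have "u i * x = (\<Prod>j\<in>UNIV. u j ^ (a(i := Suc (a i))) j)" by (rule sym)
    then have "u i * x \<in> ?V" by (simp only:) (rule span_base, rule rangeI)
    then show ?case using step by (simp add: distrib_left span_add span_scale)
  qed (simp add: span_zero)
  have mult_var: "mpoly_var i * f \<in> ?V" if "f \<in> ?V" for f i
  proof -
    obtain c d where "mpoly_var i = c *\<^sub>R u i + d *\<^sub>R 1" using var by blast
    then show ?thesis using that mult_u[OF that] by (simp add: distrib_right span_add span_scale)
  qed
  have one: "1 \<in> ?V" by (rule span_base) (auto intro!: image_eqI[where x = "\<lambda>_. 0"])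
  have power: "mpoly_var i ^ k * f \<in> ?V" if "f \<in> ?V" for f i k
    by (induction k) (use that mult_var in \<open>simp_all add: mult.assoc\<close>)
  have "(\<Prod>i\<in>I. mpoly_var i ^ g i) \<in> ?V" if "finite I" for I and g :: "'n \<Rightarrow> nat"
    using that by induction (simp_all add: one power)
  then have "monomial \<alpha> \<in> ?V" for \<alpha>
    by (simp add: monomial_eq_prod_var)
  then show ?thesis
    by (induction f rule: real_mpoly_induct) (simp_all add: span_add span_scale)
qed

lemma bounded_mpoly_on_compact:
  assumes "compact K"
  obtains B where "\<And>x. x \<in> K \<Longrightarrow> \<bar>mpoly_eval f x\<bar> \<le> B"
  using compact_imp_bounded[OF compact_continuous_image[OF continuous_on_mpoly_eval[of K f] assms]] that
  unfolding bounded_iff by auto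

section \<open>Representing measures\<close>

text \<open>
  This is a theorem of Berg and Maserick: positive semidefinite functionals of at most geometric
  growth are represented on the corresponding box. The growth bound says that the powers of the
  rescaled variables \<open>y i = X\<^sub>i / R i\<close> are bounded under \<open>L\<close>, so \<open>L\<close> is nonnegative on the Bernstein
  basis in the variables \<open>u i = (1 + y i) / 2\<close>, which run through \<open>[0, 1]\<close> when \<open>X\<^sub>i\<close> runs through
  \<open>[-R i, R i]\<close>. The measure obtained on the cube is transported back to the box.
\<close>

lemma growth_bound_imp_represented:
  fixes L :: "'n::finite real_mpoly \<Rightarrow> real" and R :: "'n \<Rightarrow> real"
  assumes L: "linear L" and psd: "positive_semidefinite L" and R: "\<And>i. 0 < R i"
    and growth: "\<And>\<alpha>. \<bar>L (monomial \<alpha>)\<bar> \<le> C * (\<Prod>i\<in>UNIV. R i ^ Poly_Mapping.lookup \<alpha> i)"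
  shows "\<exists>\<mu>. borel_measure_on {x. \<forall>i. x $ i \<in> {- R i..R i}} \<mu> \<and> represented_by L \<mu>"
proof -
  interpret L: linear L by (rule L)
  define K :: "(real ^ 'n) set" where "K = {x. \<forall>i. x $ i \<in> {- R i..R i}}"
  define y where "y i = (1 / R i) *\<^sub>R mpoly_var i" for i
  define u where "u i = (1/2) *\<^sub>R (1 + y i)" for i
  have y_power: "y i ^ k = (1 / R i ^ k) *\<^sub>R monomial (Poly_Mapping.single i k)" for i k
  proof -
    have "y i ^ k = (1 / R i) ^ k *\<^sub>R mpoly_var i ^ k"
      unfolding y_def by (induction k) (simp_all add: mult.commute)
    then show ?thesis by (simp only: mpoly_var_power power_one_over)
  qed
  have "\<exists>C. \<forall>k. \<bar>L (y i ^ k * h)\<bar> \<le> C" for i h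
  proof (induction h rule: real_mpoly_induct)
    case (monomial \<alpha>)
    have "\<bar>L (y i ^ k * monomial \<alpha>)\<bar> \<le> C * (\<Prod>j\<in>UNIV. R j ^ Poly_Mapping.lookup \<alpha> j)" for k
    proof -
      let ?e = "Poly_Mapping.single i k"
      have "(\<Prod>j\<in>UNIV. R j ^ Poly_Mapping.lookup ?e j) = (\<Prod>j\<in>UNIV. if j = i then R i ^ k else 1)"
        by (rule prod.cong) (auto simp: lookup_single when_def)
      then have "(\<Prod>j\<in>UNIV. R j ^ Poly_Mapping.lookup (?e + \<alpha>) j)
          = R i ^ k * (\<Prod>j\<in>UNIV. R j ^ Poly_Mapping.lookup \<alpha> j)"
        by (simp add: lookup_add power_add prod.distrib)
      then have "\<bar>L (monomial (?e + \<alpha>))\<bar> \<le> R i ^ k * (C * (\<Prod>j\<in>UNIV. R j ^ Poly_Mapping.lookup \<alpha> j))"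
        using growth[of "?e + \<alpha>"] by (simp add: ac_simps)
      moreover have "\<bar>L (y i ^ k * monomial \<alpha>)\<bar> = \<bar>L (monomial (?e + \<alpha>))\<bar> / R i ^ k"
        using R[of i] by (simp add: y_power L.scale monomial_add abs_mult)
      ultimately show ?thesis using R[of i] by (simp add: divide_le_eq mult.commute)
    qed
    then show ?case by blast
  next
    case (add f g)
    then obtain C D where CD: "\<And>k. \<bar>L (y i ^ k * f)\<bar> \<le> C" "\<And>k. \<bar>L (y i ^ k * g)\<bar> \<le> D" by blast
    have "\<bar>L (y i ^ k * (f + g))\<bar> \<le> C + D" for k
      using CD[of k] by (simp add: distrib_left L.add)
    then show ?case by blast
  next
    case (scale c f)
    then obtain C where C: "\<And>k. \<bar>L (y i ^ k * f)\<bar> \<le> C" by blast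
    have "\<bar>L (y i ^ k * c *\<^sub>R f)\<bar> \<le> \<bar>c\<bar> * C" for k
      using C[of k] by (simp add: L.scale abs_mult mult_left_mono)
    then show ?case by blast
  qed
  then have good: "psd_power_bounded y L"
    using L psd by (simp add: psd_power_bounded_def positive_semidefinite_def power2_eq_square)
  have u': "1 - u i = (1/2) *\<^sub>R (1 - y i)" for i
    by (simp add: u_def algebra_simps flip: scaleR_add_left)
  obtain \<nu> :: "(real ^ 'n) measure" where \<nu>: "finite_measure \<nu>" "sets \<nu> = sets borel"
    and cube: "AE z in \<nu>. \<forall>i. z $ i \<in> {0..1}"
    and moment: "\<And>a. L (\<Prod>i\<in>UNIV. u i ^ a i) = (\<integral>z. (\<Prod>i\<in>UNIV. (z $ i) ^ a i) \<partial>\<nu>)"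
  proof (rule positive_on_Bernstein_imp_moments[OF L, of u])
    show "0 \<le> L (\<Prod>i\<in>UNIV. u i ^ a i * (1 - u i) ^ b i)" for a b
      unfolding u' unfolding u_def by (rule psd_power_bounded_product_nonneg[OF good])
  qed blast
  interpret \<nu>: finite_measure \<nu> by (rule \<nu>)
  \<comment> \<open>The truncation to \<open>[0, 1]\<close> makes \<open>T\<close> map into \<open>K\<close> everywhere and is the identity almost everywhere.\<close>
  define T :: "real ^ 'n \<Rightarrow> real ^ 'n" where "T z = (\<chi> i. R i * (2 * max 0 (min 1 (z $ i)) - 1))" for z
  have T_in_K: "T z \<in> K" for z
  proof -
    have "\<bar>R i * (2 * max 0 (min 1 (z $ i)) - 1)\<bar> \<le> R i * 1" for i
      unfolding abs_mult using R[of i] by (intro mult_mono) auto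
    then have "- R i \<le> T z $ i" "T z $ i \<le> R i" for i
      by (simp_all add: T_def abs_le_iff minus_le_iff)
    then show ?thesis by (simp add: K_def)
  qed
  have T_cont: "continuous_on UNIV T"
    unfolding T_def by (intro continuous_intros)
  have T_meas: "T \<in> measurable \<nu> (restrict_space borel K)"
    using T_in_K borel_measurable_continuous_onI[OF T_cont]
    by (intro measurable_restrict_space2) (auto simp: measurable_cong_sets[OF \<nu>(2) refl])
  have K: "K = cbox (\<chi> i. - R i) (\<chi> i. R i)"
    by (auto simp: K_def mem_box_cart)
  have eval_meas: "mpoly_eval f \<in> borel_measurable (restrict_space borel K)" for f
    by (intro measurable_restrict_space1 borel_measurable_continuous_onI continuous_on_mpoly_eval)
  have integrable: "integrable \<nu> (\<lambda>z. mpoly_eval f (T z))" for f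
  proof -
    obtain B where "\<And>x. x \<in> K \<Longrightarrow> \<bar>mpoly_eval f x\<bar> \<le> B"
      using bounded_mpoly_on_compact[of K f] compact_cbox unfolding K by blast
    then show ?thesis
      using T_in_K measurable_compose[OF T_meas eval_meas]
      by (intro \<nu>.integrable_const_bound[where B = B]) auto
  qed
  have represents: "L f = (\<integral>z. mpoly_eval f (T z) \<partial>\<nu>)" for f
  proof -
    have "linear (\<lambda>f. \<integral>z. mpoly_eval f (T z) \<partial>\<nu>)"
      by (rule linearI) (simp_all add: mpoly_eval_add mpoly_eval_scaleR integrable)
    moreover have "L h = (\<integral>z. mpoly_eval h (T z) \<partial>\<nu>)" if "h \<in> range (\<lambda>a. \<Prod>i\<in>UNIV. u i ^ a i)" for h
    proof -
      from that obtain a where h: "h = (\<Prod>i\<in>UNIV. u i ^ a i)" by blast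
      have "mpoly_eval (u i) (T z) = max 0 (min 1 (z $ i))" for i z
        using R[of i]
        by (simp add: u_def y_def mpoly_eval_scaleR mpoly_eval_add mpoly_eval_1 mpoly_eval_var T_def field_simps)
      then have "mpoly_eval h (T z) = (\<Prod>i\<in>UNIV. max 0 (min 1 (z $ i)) ^ a i)" for z
        by (simp add: h mpoly_eval_prod mpoly_eval_power)
      moreover have "(\<integral>z. (\<Prod>i\<in>UNIV. max 0 (min 1 (z $ i)) ^ a i) \<partial>\<nu>) = (\<integral>z. (\<Prod>i\<in>UNIV. (z $ i) ^ a i) \<partial>\<nu>)"
      proof (rule integral_cong_AE)
        have [measurable_cong]: "sets \<nu> = sets borel" by (rule \<nu>)
        show "(\<lambda>z. \<Prod>i\<in>UNIV. max 0 (min 1 (z $ i)) ^ a i) \<in> borel_measurable \<nu>" by measurable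
        show "(\<lambda>z. \<Prod>i\<in>UNIV. (z $ i) ^ a i) \<in> borel_measurable \<nu>" by measurable
        show "AE z in \<nu>. (\<Prod>i\<in>UNIV. max 0 (min 1 (z $ i)) ^ a i) = (\<Prod>i\<in>UNIV. (z $ i) ^ a i)"
          using cube
        proof eventually_elim
          case (elim z)
          then have "max 0 (min 1 (z $ i)) = z $ i" for i by simp
          then show ?case by simp
        qed
      qed
      ultimately show ?thesis by (simp add: h moment)
    qed
    moreover have "f \<in> span (range (\<lambda>a. \<Prod>i\<in>UNIV. u i ^ a i))"
    proof (rule span_affine_monomials)
      fix i
      have "mpoly_var i = (2 * R i) *\<^sub>R u i + (- R i) *\<^sub>R 1"
        using R[of i] by (simp add: u_def y_def scaleR_add_right)
      then show "\<exists>c d. mpoly_var i = c *\<^sub>R u i + d *\<^sub>R 1" by blast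
    qed
    ultimately show ?thesis using linear_eq_on_span[OF L] by blast
  qed
  have "represented_by L (distr \<nu> (restrict_space borel K) T)"
    unfolding represented_by_def
    using integrable represents
    by (simp add: integrable_distr_eq[OF T_meas eval_meas] integral_distr[OF T_meas eval_meas])
  moreover have "borel_measure_on K (distr \<nu> (restrict_space borel K) T)"
    by (simp add: borel_measure_on_def)
  ultimately show ?thesis unfolding K_def by blast
qed

text \<open>
  A single term of a convergent series of nonnegative terms is at most its sum. Taking the \<open>q\<close>-th
  root of this bound gives a geometric growth bound with \<open>R i = r i powr (1 / p)\<close>.
\<close>

theorem theorem3p14:
  fixes p q :: real
    and r :: "real ^ 'n::finite"
    and L :: "'n real_mpoly \<Rightarrow> real"
  assumes "1 < p"
    and "1 / p + 1 / q = 1"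
    and "\<And>i. 0 < r $ i"
    and "linear L"
    and "(\<lambda>\<alpha>. \<bar>L (monomial \<alpha>)\<bar> powr q *
           (\<Prod>i\<in>UNIV. (r $ i) powr (- (q / p) * real (Poly_Mapping.lookup \<alpha> i)))) summable_on UNIV"
  shows "positive_semidefinite L \<longleftrightarrow>
    (\<exists>\<mu>. borel_measure_on {x. \<forall>i. x $ i \<in> {- ((r $ i) powr (1 / p)) .. (r $ i) powr (1 / p)}} \<mu>
       \<and> represented_by L \<mu>)"
proof
  assume "\<exists>\<mu>. borel_measure_on {x. \<forall>i. x $ i \<in> {- ((r $ i) powr (1 / p)) .. (r $ i) powr (1 / p)}} \<mu>
       \<and> represented_by L \<mu>"
  then obtain \<mu> where "\<And>f. L f = (\<integral>x. mpoly_eval f x \<partial>\<mu>)"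
    unfolding represented_by_def by blast
  then show "positive_semidefinite L"
    by (simp add: positive_semidefinite_def mpoly_eval_power)
next
  assume psd: "positive_semidefinite L"
  have q: "0 < q"
  proof -
    have "1 / p < 1" using assms(1) by simp
    then have "0 < 1 / q" using assms(2) by linarith
    then show ?thesis by simp
  qed
  define R where "R i = (r $ i) powr (1 / p)" for i
  have R: "0 < R i" for i using assms(3)[of i] by (simp add: R_def)
  define t where "t \<alpha> = \<bar>L (monomial \<alpha>)\<bar> powr q *
      (\<Prod>i\<in>UNIV. (r $ i) powr (- (q / p) * real (Poly_Mapping.lookup \<alpha> i)))" for \<alpha>
  have t_nonneg: "0 \<le> t \<alpha>" for \<alpha> by (simp add: t_def prod_nonneg)
  have t_le: "t \<alpha> \<le> infsum t UNIV" for \<alpha>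
    using finite_sum_le_infsum[of t UNIV "{\<alpha>}"] assms(5) t_nonneg by (simp add: t_def[abs_def])
  have "\<bar>L (monomial \<alpha>)\<bar> \<le> infsum t UNIV powr (1 / q) * (\<Prod>i\<in>UNIV. R i ^ Poly_Mapping.lookup \<alpha> i)" for \<alpha>
  proof -
    let ?P = "\<Prod>i\<in>UNIV. R i ^ Poly_Mapping.lookup \<alpha> i"
    have P: "0 < ?P" using R by (simp add: prod_pos)
    have "(r $ i) powr (- (q / p) * real k) = inverse ((R i ^ k) powr q)" for i k
      using assms(3)[of i] by (simp add: R_def powr_powr powr_minus mult.commute flip: powr_realpow)
    then have "t \<alpha> = \<bar>L (monomial \<alpha>)\<bar> powr q * inverse (\<Prod>i\<in>UNIV. (R i ^ Poly_Mapping.lookup \<alpha> i) powr q)"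
      by (simp add: t_def flip: prod_inversef)
    also have "(\<Prod>i\<in>UNIV. (R i ^ Poly_Mapping.lookup \<alpha> i) powr q) = ?P powr q"
      by (rule prod_powr_distrib[symmetric])
    also have "\<bar>L (monomial \<alpha>)\<bar> powr q * inverse (?P powr q) = (\<bar>L (monomial \<alpha>)\<bar> / ?P) powr q"
      by (simp add: powr_divide flip: divide_inverse)
    finally have t_eq: "t \<alpha> = (\<bar>L (monomial \<alpha>)\<bar> / ?P) powr q" .
    have "t \<alpha> powr (1 / q) \<le> infsum t UNIV powr (1 / q)"
      using t_le t_nonneg q by (intro powr_mono2) auto
    then have "\<bar>L (monomial \<alpha>)\<bar> / ?P \<le> infsum t UNIV powr (1 / q)"
      unfolding t_eq using P q by (simp add: powr_powr)
    then show ?thesis using P by (simp add: divide_le_eq)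
  qed
  from growth_bound_imp_represented[OF assms(4) psd R this]
  show "\<exists>\<mu>. borel_measure_on {x. \<forall>i. x $ i \<in> {- ((r $ i) powr (1 / p)) .. (r $ i) powr (1 / p)}} \<mu>
       \<and> represented_by L \<mu>"
    by (simp add: R_def)
qed

end
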